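(* Let $ABCD$ be a nondegenerate quadrilateral and let $S$ be its Simson point. For a point $P$ of the plane, the feet of the perpendiculars dropped from $P$ to the four side lines $AB,BC,CD,DA$ lie on a straight line if and only if $P=S$. (If $S$ is the point at infinity, as for a parallelogram, no point of the plane has this property.)
   Context: A quadrilateral is a simple quadrilateral (convex or concave), no three of whose vertices are collinear. $(XYZ)$ denotes the circle through $X,Y,Z$, or the line through them if they are collinear. The plane is completed by one point at infinity, which lies on every line. For circles $o,o'$ with centers $O,O'$ and radii $R,R'$, the circle of similitude $CS(o,o')$ is the set of points $P$ with $|PO|/|PO'|=R/R'$ (if $R=R'$ it is the perpendicular bisector of $OO'$ together with the point at infinity). Definition of the Simson point. Let $o_1=(DAB)$, $o_2=(ABC)$, $o_3=(BCD)$, $o_4=(CDA)$. If $ABCD$ is noncyclic, all six circles of similitude $CS(o_i,o_j)$, $i\neq j$, have a common point $W$ (in the completed plane), namely the intersection point of $CS(o_1,o_2)$ and $CS(o_1,o_4)$ other than $A$; the Simson point $S$ is the second intersection point of $CS(o_1,o_3)$ and $CS(o_2,o_4)$, so that $CS(o_1,o_3)\cap CS(o_2,o_4)=\{W,S\}$. If $ABCD$ is cyclic with circumcenter $O$, then $W=O$ and $S$ is the intersection point of $(BOD)$ and $(AOC)$ other than $O$. *)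

theory Defs
  imports "HOL-Analysis.Analysis"
begin

type_synonym point = "real ^ 2"

text \<open>The plane completed by one point at infinity: \<open>Some P\<close> is the ordinary point \<open>P\<close>,
  \<open>None\<close> is the point at infinity.\<close>

type_synonym ext_point = "(real ^ 2) option"

text \<open>Two adjacent sides meet only in their common vertex because no three vertices are
  collinear, so simplicity only has to be required of the two pairs of opposite sides.\<close>

definition nondegenerate_quadrilateral :: "point \<Rightarrow> point \<Rightarrow> point \<Rightarrow> point \<Rightarrow> bool" where
  "nondegenerate_quadrilateral A B C D \<longleftrightarrow>
     \<not> collinear {A, B, C} \<and> \<not> collinear {B, C, D} \<and>
     \<not> collinear {C, D, A} \<and> \<not> collinear {D, A, B} \<and>
     closed_segment A B \<inter> closed_segment C D = {} \<and>
     closed_segment B C \<inter> closed_segment D A = {}"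

definition cyclic_quadrilateral :: "point \<Rightarrow> point \<Rightarrow> point \<Rightarrow> point \<Rightarrow> bool" where
  "cyclic_quadrilateral A B C D \<longleftrightarrow> (\<exists>Z R. {A, B, C, D} \<subseteq> sphere Z R)"

text \<open>Meaningful only for non-collinear \<open>X\<close>, \<open>Y\<close>, \<open>Z\<close>.\<close>

definition circumcenter :: "point \<Rightarrow> point \<Rightarrow> point \<Rightarrow> point" where
  "circumcenter X Y Z = (THE Q. dist X Q = dist Y Q \<and> dist Y Q = dist Z Q)"

definition circumradius :: "point \<Rightarrow> point \<Rightarrow> point \<Rightarrow> real" where
  "circumradius X Y Z = dist X (circumcenter X Y Z)"

text \<open>The generalized circle \<open>(XYZ)\<close>; a line contains the point at infinity.\<close>

definition gen_circle :: "point \<Rightarrow> point \<Rightarrow> point \<Rightarrow> ext_point set" where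
  "gen_circle X Y Z =
     (if collinear {X, Y, Z} then insert None (Some ` (affine hull {X, Y, Z}))
      else Some ` sphere (circumcenter X Y Z) (circumradius X Y Z))"

text \<open>A circle given by its center and radius.\<close>

type_synonym circle = "(real ^ 2) \<times> real"

definition circumcircle :: "point \<Rightarrow> point \<Rightarrow> point \<Rightarrow> circle" where
  "circumcircle X Y Z = (circumcenter X Y Z, circumradius X Y Z)"

text \<open>The center of the second circle is not in the set although division by zero yields
  zero, because the radii are positive.\<close>

definition circle_of_similitude :: "circle \<Rightarrow> circle \<Rightarrow> ext_point set" where
  "circle_of_similitude c c' =
     Some ` {P. dist P (fst c) / dist P (fst c') = snd c / snd c'} \<union>
     (if snd c = snd c' then {None} else {})"

text \<open>The four circles are $o_1 = (DAB)$, $o_2 = (ABC)$, $o_3 = (BCD)$, $o_4 = (CDA)$.\<close>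

definition isoptic_point :: "point \<Rightarrow> point \<Rightarrow> point \<Rightarrow> point \<Rightarrow> ext_point" where
  "isoptic_point A B C D =
     (if cyclic_quadrilateral A B C D then Some (circumcenter A B C)
      else (THE W. W \<in> circle_of_similitude (circumcircle D A B) (circumcircle A B C) \<and>
                   W \<in> circle_of_similitude (circumcircle D A B) (circumcircle C D A) \<and>
                   W \<noteq> Some A))"

definition simson_point :: "point \<Rightarrow> point \<Rightarrow> point \<Rightarrow> point \<Rightarrow> ext_point" where
  "simson_point A B C D =
     (if cyclic_quadrilateral A B C D
      then (let Q = circumcenter A B C in
            THE S. S \<in> gen_circle B Q D \<and> S \<in> gen_circle A Q C \<and> S \<noteq> Some Q)
      else (THE S. circle_of_similitude (circumcircle D A B) (circumcircle B C D) \<inter>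
                   circle_of_similitude (circumcircle A B C) (circumcircle C D A) =
                   {isoptic_point A B C D, S}))"

text \<open>The foot of the perpendicular from \<open>P\<close> to the line through the distinct points
  \<open>X\<close> and \<open>Y\<close>.\<close>

definition foot :: "point \<Rightarrow> point \<Rightarrow> point \<Rightarrow> point" where
  "foot P X Y = (THE F. F \<in> affine hull {X, Y} \<and> orthogonal (P - F) (Y - X))"

end

theory Submission
  imports Defs
begin

text \<open>
  Both sides of the equivalence are characterised by one equation between complex numbers.
  Identify the plane with the complex numbers and write lower case letters for coordinates. Then
  \<open>P\<close> has collinear feet, and also \<open>P\<close> is the Simson point, if and only if
  \<open>(a - p) * (c - p) = (b - p) * (d - p)\<close>. This equation is linear in \<open>p\<close>; its only root is the
  center of the spiral similarity that takes \<open>A\<close> to \<open>B\<close> and \<open>D\<close> to \<open>C\<close>, and there is none for a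
  parallelogram.

  Feet (\<open>collinear_feet_iff\<close>). With \<open>P\<close> at the origin, three consecutive feet are collinear exactly
  if \<open>P\<close> satisfies Simson's angle condition for the triangle cut out by the three side lines, which
  is a reality condition on a product of four complex numbers. The four conditions together
  force \<open>a * c = b * d\<close>, and this equation in turn implies each of them.

  Simson point, noncyclic case (\<open>simson_point_noncyclic_iff\<close>). All circles of similitude that
  define \<open>W\<close> and all but one of those that define \<open>S\<close> pass through \<open>A\<close>, so an inversion at \<open>A\<close>
  turns them into lines. Normalised such that the images \<open>b\<close>, \<open>c\<close>, \<open>d\<close> of the other vertices lie
  on the unit circle, and with \<open>a\<close> for the image of infinity, these lines are the perpendicular
  bisectors between the mirror images of \<open>a\<close> in the sides of the triangle \<open>bcd\<close>. Hence \<open>W\<close> becomes the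
  isogonal conjugate of \<open>a\<close> in this triangle. The remaining circle meets the line of the other
  pair in two points, found by factoring one polynomial: the image of \<open>W\<close>
  and the point \<open>s\<close> with \<open>(s - c) * (a - c) = (b - c) * (d - c)\<close>, which is the inverted form of the
  equation for \<open>p\<close>. The factorisation covers tangency as well, so \<open>W = S\<close> needs no separate
  treatment, and the point at infinity is the ordinary value \<open>a\<close> of the inverted coordinate.

  Simson point, cyclic case (\<open>simson_point_cyclic_iff\<close>). An inversion at the circumcenter turns
  the two circles into the diagonals. They meet in one point because in a simple quadrilateral
  the diagonals are not parallel (\<open>diagonals_not_parallel\<close>).
\<close>

section \<open>Complex coordinates\<close>

definition cx :: "point \<Rightarrow> complex" where
  "cx P = Complex (P $ 1) (P $ 2)"

definition pt :: "complex \<Rightarrow> point" where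
  "pt z = vector [Re z, Im z]"

lemma cx_pt [simp]: "cx (pt z) = z"
  by (simp add: cx_def pt_def)

lemma cx_eq_iff [simp]: "cx P = cx Q \<longleftrightarrow> P = Q"
  by (auto simp: cx_def vec_eq_iff forall_2)

lemma cx_diff [simp]: "cx (P - Q) = cx P - cx Q"
  and cx_add [simp]: "cx (P + Q) = cx P + cx Q"
  and cx_scaleR [simp]: "cx (r *\<^sub>R P) = of_real r * cx P"
  by (simp_all add: cx_def complex_eq_iff)

lemma inner_cx: "inner P Q = Re (cx P * cnj (cx Q))"
  by (simp add: cx_def inner_vec_def sum_2)

lemma dist_cx: "dist P Q = cmod (cx P - cx Q)"
  by (simp add: dist_norm norm_vec_def L2_set_def sum_2 cx_def cmod_def)

text \<open>Equal distances become polynomial equations in complex numbers and their conjugates; this is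
  the form in which all later distance conditions are handled.\<close>

lemma cmod_eq_iff: "cmod u = cmod v \<longleftrightarrow> u * cnj u = v * cnj v"
proof -
  have "cmod u = cmod v \<longleftrightarrow> complex_of_real ((cmod u)\<^sup>2) = complex_of_real ((cmod v)\<^sup>2)"
    by (simp only: of_real_eq_iff power2_eq_iff_nonneg [OF norm_ge_zero norm_ge_zero])
  then show ?thesis
    by (simp only: complex_norm_square)
qed

lemma collinear_cx:
  "collinear {A, B, C} \<longleftrightarrow>
     (cx B - cx A) * cnj (cx C - cx A) = cnj (cx B - cx A) * (cx C - cx A)"
proof -
  have "collinear {A, B, C} \<longleftrightarrow> collinear {B, A, C}"
    by (simp add: insert_commute)
  also have "\<dots> \<longleftrightarrow> collinear {0, B - A, C - A}"
    using collinear_3 [of B A C, unfolded NO_MATCH_def] by blast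
  also have "\<dots> \<longleftrightarrow> \<bar>inner (B - A) (C - A)\<bar> = norm (B - A) * norm (C - A)"
    by (rule norm_cauchy_schwarz_equal [symmetric])
  also have "\<dots> \<longleftrightarrow> (inner (B - A) (C - A))\<^sup>2 = inner (B - A) (B - A) * inner (C - A) (C - A)"
    by (simp only: dot_square_norm flip: power_mult_distrib)
       (metis abs_ge_zero mult_nonneg_nonneg norm_ge_zero power2_abs power2_eq_iff_nonneg)
  also have "\<dots> \<longleftrightarrow> (Im ((cx B - cx A) * cnj (cx C - cx A)))\<^sup>2 = 0"
    by (simp add: inner_cx power2_eq_square) algebra
  also have "\<dots> \<longleftrightarrow> (cx B - cx A) * cnj (cx C - cx A) = cnj (cx B - cx A) * (cx C - cx A)"
    by (auto simp: complex_eq_iff algebra_simps)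
  finally show ?thesis .
qed

lemma cx_foot:
  fixes P X Y :: point
  assumes "X \<noteq> Y"
  defines "x \<equiv> cx X - cx P" and "y \<equiv> cx Y - cx P"
  shows "cx (foot P X Y) = cx P + (x * cnj y - cnj x * y) / (2 * (cnj y - cnj x))"
proof -
  define t where "t = inner (P - X) (Y - X) / inner (Y - X) (Y - X)"
  have nz: "inner (Y - X) (Y - X) \<noteq> 0"
    using assms(1) by simp
  have foot: "foot P X Y = X + t *\<^sub>R (Y - X)"
    unfolding foot_def
  proof (rule the_equality)
    show "X + t *\<^sub>R (Y - X) \<in> affine hull {X, Y} \<and>
          orthogonal (P - (X + t *\<^sub>R (Y - X))) (Y - X)"
    proof
      show "X + t *\<^sub>R (Y - X) \<in> affine hull {X, Y}"
        by (auto simp: affine_hull_2_alt)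
      have "inner (P - (X + t *\<^sub>R (Y - X))) (Y - X) =
          inner (P - X) (Y - X) - t * inner (Y - X) (Y - X)"
        by (simp add: inner_diff_left inner_add_left)
      then show "orthogonal (P - (X + t *\<^sub>R (Y - X))) (Y - X)"
        using nz by (simp add: orthogonal_def t_def)
    qed
  next
    fix F assume F: "F \<in> affine hull {X, Y} \<and> orthogonal (P - F) (Y - X)"
    then obtain s where s: "F = X + s *\<^sub>R (Y - X)"
      by (auto simp: affine_hull_2_alt)
    have "inner (P - X) (Y - X) = s * inner (Y - X) (Y - X)"
      using F unfolding s orthogonal_def
      by (simp add: inner_diff_left inner_add_left)
    then show "F = X + t *\<^sub>R (Y - X)"
      using nz by (simp add: s t_def)
  qed
  have ne: "y - x \<noteq> 0" "cnj (y - x) \<noteq> 0"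
    using assms by auto
  have re: "complex_of_real (Re w) = (w + cnj w) / 2" for w
    by (simp add: complex_add_cnj)
  have "complex_of_real (inner (P - X) (Y - X)) = (- x * cnj (y - x) + cnj (- x) * (y - x)) / 2"
    unfolding inner_cx re by (simp add: x_def y_def)
  moreover have "complex_of_real (inner (Y - X) (Y - X)) = (y - x) * cnj (y - x)"
    unfolding inner_cx re by (simp add: x_def y_def)
  ultimately have "of_real t = (- x * cnj (y - x) + cnj (- x) * (y - x)) / (2 * ((y - x) * cnj (y - x)))"
    by (simp only: t_def of_real_divide divide_divide_eq_left)
  then have "cx (foot P X Y) = cx P + x +
      (- x * cnj (y - x) + cnj (- x) * (y - x)) / (2 * ((y - x) * cnj (y - x))) * (y - x)"
    by (simp add: foot x_def y_def)
  also have "\<dots> = cx P + (x * cnj y - cnj x * y) / (2 * (cnj y - cnj x))"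
    using ne by (simp add: divide_simps) (simp add: algebra_simps)
  finally show ?thesis .
qed

section \<open>Collinear feet\<close>

text \<open>The quotient of \<open>u\<close> and \<open>v\<close> is real; the zero vector counts as parallel to everything.\<close>

definition parallel :: "complex \<Rightarrow> complex \<Rightarrow> bool" where
  "parallel u v \<longleftrightarrow> u * cnj v = cnj u * v"

text \<open>The foot of the perpendicular from the origin to the line through \<open>x\<close> and \<open>y\<close>.\<close>

definition foot0 :: "complex \<Rightarrow> complex \<Rightarrow> complex" where
  "foot0 x y = (x * cnj y - cnj x * y) / (2 * (cnj y - cnj x))"

text \<open>The feet on two lines through \<open>b\<close> lie on the circle with diameter from \<open>0\<close> to \<open>b\<close>, so the
  direction of the chord between them depends only on \<open>b\<close> and the directions of the two lines.\<close>

lemma foot0_diff: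
  assumes "a \<noteq> b" "b \<noteq> c"
  shows "foot0 a b - foot0 b c =
    cnj b * ((c - b) * cnj (b - a) - (b - a) * cnj (c - b)) / (2 * (cnj (b - a) * cnj (c - b)))"
proof -
  have "cnj b - cnj a \<noteq> 0" "cnj c - cnj b \<noteq> 0"
    using assms by auto
  then show ?thesis
    unfolding foot0_def by (simp add: divide_simps) (simp add: algebra_simps)
qed

lemma foot0_eq_iff:
  assumes "\<not> parallel (b - a) (c - b)"
  shows "foot0 a b = foot0 b c \<longleftrightarrow> b = 0"
proof -
  have "a \<noteq> b" "b \<noteq> c" "(c - b) * cnj (b - a) - (b - a) * cnj (c - b) \<noteq> 0"
    using assms by (auto simp: parallel_def mult.commute)
  then show ?thesis
    using foot0_diff [of a b c] by (auto simp: eq_iff_diff_eq_0 [of "foot0 a b"])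
qed

text \<open>Simson's theorem for the lines \<open>ab\<close>, \<open>bc\<close>, \<open>cd\<close>: the right-hand side says that the angle
  under which \<open>bc\<close> is seen from the origin agrees, up to multiples of \<open>\<pi>\<close>, with the angle between
  \<open>ab\<close> and \<open>cd\<close>, that is, the origin lies on the circumcircle of the triangle cut out by the lines.
  In this form it also covers parallel lines \<open>ab\<close> and \<open>cd\<close>.\<close>

lemma parallel_foot0_iff:
  assumes "\<not> parallel (b - a) (c - b)" "\<not> parallel (c - b) (d - c)"
  shows "parallel (foot0 a b - foot0 b c) (foot0 c d - foot0 b c) \<longleftrightarrow>
    cnj b * c * (b - a) * cnj (d - c) = b * cnj c * cnj (b - a) * (d - c)"
proof -
  define U V W where "U = b - a" and "V = c - b" and "W = d - c"
  define K where "K = (V * cnj U - U * cnj V) * (cnj V * W - V * cnj W) / (4 * V * cnj V)"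
  have ne: "U \<noteq> 0" "V \<noteq> 0" "W \<noteq> 0" "K \<noteq> 0"
    using assms by (auto simp: parallel_def mult.commute U_def V_def W_def K_def)
  have 1: "foot0 a b - foot0 b c = cnj b * (V * cnj U - U * cnj V) / (2 * (cnj U * cnj V))"
    using foot0_diff [of a b c] ne by (auto simp: U_def V_def)
  have 2: "foot0 c d - foot0 b c = cnj c * (V * cnj W - W * cnj V) / (2 * (cnj V * cnj W))"
    using foot0_diff [of b c d] ne
    by (auto simp: W_def V_def eq_iff_diff_eq_0 [of "foot0 c d"] algebra_simps diff_divide_distrib)
  \<comment> \<open>The two products whose equality means parallel chords share the factor \<open>K\<close>, which is nonzero
    because neighbouring lines are not parallel.\<close>
  have 3: "(foot0 a b - foot0 b c) * cnj (foot0 c d - foot0 b c) = cnj b * c / (cnj U * W) * K"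
    unfolding 1 2 K_def using ne(1-3) by (simp add: divide_simps)
  have 4: "cnj (foot0 a b - foot0 b c) * (foot0 c d - foot0 b c) = b * cnj c / (U * cnj W) * K"
    unfolding 1 2 K_def using ne(1-3) by (simp add: divide_simps) algebra
  have "parallel (foot0 a b - foot0 b c) (foot0 c d - foot0 b c) \<longleftrightarrow>
      cnj b * c / (cnj U * W) * K = b * cnj c / (U * cnj W) * K"
    unfolding parallel_def 3 4 ..
  also have "\<dots> \<longleftrightarrow> cnj b * c * U * cnj W = b * cnj c * cnj U * W"
    using ne by (simp add: divide_simps mult_ac)
  finally show ?thesis
    by (simp add: U_def W_def)
qed

text \<open>The four angle conditions together. The first and the third show that \<open>b * d / (a * c)\<close> is
  real. If it is not \<open>1\<close>, the first one puts the origin on the line \<open>ab\<close> and the fourth one puts it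
  on \<open>bc\<close>, so the origin is the vertex \<open>b\<close>, which the second condition excludes.\<close>

lemma collinear_feet_imp_products_eq:
  fixes a b c d :: complex
  assumes T1: "cnj b * c * (b - a) * cnj (d - c) = b * cnj c * cnj (b - a) * (d - c)"
    and T2: "cnj c * d * (c - b) * cnj (a - d) = c * cnj d * cnj (c - b) * (a - d)"
    and T3: "cnj d * a * (d - c) * cnj (b - a) = d * cnj a * cnj (d - c) * (b - a)"
    and T4: "cnj a * b * (a - d) * cnj (c - b) = a * cnj b * cnj (a - d) * (c - b)"
    and nd: "\<not> parallel (b - a) (c - b)" "\<not> parallel (c - b) (d - c)"
      "\<not> parallel (d - c) (a - d)" "\<not> parallel (a - d) (b - a)"
  shows "a * c = b * d"
proof (rule ccontr)
  assume ne: "a * c \<noteq> b * d"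
  have sides: "b - a \<noteq> 0" "c - b \<noteq> 0" "d - c \<noteq> 0" "a - d \<noteq> 0"
    using nd by (auto simp: parallel_def)
  \<comment> \<open>For \<open>a = 0\<close> the first condition says that \<open>c\<close> and \<open>d\<close> are aligned with \<open>a\<close>; the other
    vertices are excluded in the same way.\<close>
  have "a \<noteq> 0"
    using T1 sides nd by (auto simp: parallel_def algebra_simps)
  have "b \<noteq> 0"
    using T2 sides nd by (auto simp: parallel_def algebra_simps)
  have "c \<noteq> 0"
    using T3 sides nd by (auto simp: parallel_def algebra_simps)
  have "(b - a) * cnj (d - c) * (cnj (b - a) * (d - c)) * (cnj b * c * cnj d * a) =
        (b - a) * cnj (d - c) * (cnj (b - a) * (d - c)) * (b * cnj c * d * cnj a)"
    using arg_cong2 [OF T1 T3, of "(*)"] by (simp add: mult_ac)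
  then have K: "cnj b * c * cnj d * a = b * cnj c * d * cnj a"
    using sides by auto
  have "c * cnj c * (a * c - b * d) * (a * cnj b - cnj a * b) = 0"
  proof -
    have "c * cnj c * (a * c - b * d) * (a * cnj b - cnj a * b) =
        a * c * (cnj b * c * (b - a) * cnj (d - c) - b * cnj c * cnj (b - a) * (d - c))
        + (a * c - b * c) * (cnj b * c * cnj d * a - b * cnj c * d * cnj a)"
      by (simp add: algebra_simps)
    then show ?thesis using T1 K by simp
  qed
  then have 1: "a * cnj b = cnj a * b"
    using ne \<open>c \<noteq> 0\<close> by auto
  have "a * cnj a * (a * c - b * d) * (c * cnj b - cnj c * b) = 0"
  proof -
    have "a * cnj a * (a * c - b * d) * (c * cnj b - cnj c * b) =
        a * c * (a * cnj b * cnj (a - d) * (c - b) - cnj a * b * (a - d) * cnj (c - b))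
        + (a * c - a * b) * (cnj b * c * cnj d * a - b * cnj c * d * cnj a)"
      by (simp add: algebra_simps)
    then show ?thesis using T4 K by simp
  qed
  then have 2: "c * cnj b = cnj c * b"
    using ne \<open>a \<noteq> 0\<close> by auto
  have "b * cnj b * (a * cnj c) = b * cnj b * (cnj a * c)"
    using 1 2 by algebra
  then have "a * cnj c = cnj a * c"
    using \<open>b \<noteq> 0\<close> by auto
  then have "parallel (b - a) (c - b)"
    using 1 2 unfolding parallel_def complex_cnj_diff by algebra
  then show False using nd by auto
qed

text \<open>With \<open>P\<close> moved to the origin, collinear feet give the four angle conditions for consecutive
  triples. Conversely, \<open>a * c = b * d\<close> turns every angle condition into an identity.\<close>

lemma collinear_feet_iff:
  fixes A B C D P :: point
  assumes nd: "\<not> collinear {A, B, C}" "\<not> collinear {B, C, D}"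
    "\<not> collinear {C, D, A}" "\<not> collinear {D, A, B}"
  shows "collinear {foot P A B, foot P B C, foot P C D, foot P D A} \<longleftrightarrow>
    (cx A - cx P) * (cx C - cx P) = (cx B - cx P) * (cx D - cx P)"
proof -
  define a b c d where "a = cx A - cx P" and "b = cx B - cx P"
    and "c = cx C - cx P" and "d = cx D - cx P"
  note defs = a_def b_def c_def d_def
  have dist: "A \<noteq> B" "B \<noteq> C" "C \<noteq> D" "D \<noteq> A"
    using nd by (auto simp: insert_commute)
  have nd': "\<not> parallel (b - a) (c - b)" "\<not> parallel (c - b) (d - c)"
      "\<not> parallel (d - c) (a - d)" "\<not> parallel (a - d) (b - a)"
    using nd unfolding collinear_cx parallel_def defs by (auto simp: algebra_simps)
  let ?F1 = "foot P A B" and ?F2 = "foot P B C" and ?F3 = "foot P C D" and ?F4 = "foot P D A"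
  have feet: "cx ?F1 = cx P + foot0 a b" "cx ?F2 = cx P + foot0 b c"
    "cx ?F3 = cx P + foot0 c d" "cx ?F4 = cx P + foot0 d a"
    using dist by (simp_all add: cx_foot foot0_def defs)
  have col: "collinear {X, Y, Z} \<longleftrightarrow> parallel (cx X - cx Y) (cx Z - cx Y)" for X Y Z
    using collinear_cx [of Y X Z] by (simp add: insert_commute parallel_def)
  have T1: "collinear {?F1, ?F2, ?F3} \<longleftrightarrow>
      cnj b * c * (b - a) * cnj (d - c) = b * cnj c * cnj (b - a) * (d - c)"
    unfolding parallel_foot0_iff [OF nd'(1,2), symmetric] by (simp add: col feet)
  have T2: "collinear {?F2, ?F3, ?F4} \<longleftrightarrow>
      cnj c * d * (c - b) * cnj (a - d) = c * cnj d * cnj (c - b) * (a - d)"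
    unfolding parallel_foot0_iff [OF nd'(2,3), symmetric] by (simp add: col feet)
  have T3: "collinear {?F3, ?F4, ?F1} \<longleftrightarrow>
      cnj d * a * (d - c) * cnj (b - a) = d * cnj a * cnj (d - c) * (b - a)"
    unfolding parallel_foot0_iff [OF nd'(3,4), symmetric] by (simp add: col feet)
  have T4: "collinear {?F4, ?F1, ?F2} \<longleftrightarrow>
      cnj a * b * (a - d) * cnj (c - b) = a * cnj b * cnj (a - d) * (c - b)"
    unfolding parallel_foot0_iff [OF nd'(4,1), symmetric] by (simp add: col feet)
  have "collinear {?F1, ?F2, ?F3, ?F4} \<longleftrightarrow> a * c = b * d"
  proof
    assume "collinear {?F1, ?F2, ?F3, ?F4}"
    then have "collinear {?F1, ?F2, ?F3}" "collinear {?F2, ?F3, ?F4}"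
      "collinear {?F3, ?F4, ?F1}" "collinear {?F4, ?F1, ?F2}"
      by (auto elim: collinear_subset)
    then show "a * c = b * d"
      unfolding T1 T2 T3 T4 using nd' by (rule collinear_feet_imp_products_eq)
  next
    assume eq: "a * c = b * d"
    have eq': "cnj a * cnj c = cnj b * cnj d"
      using arg_cong [OF eq, of cnj] by simp
    have "b \<noteq> c" "c \<noteq> d"
      using dist by (auto simp: defs)
    then have "c \<noteq> 0"
      using eq by auto
    \<comment> \<open>Two different feet are needed to combine two collinear triples into a collinear
      quadruple.\<close>
    then have "?F2 \<noteq> ?F3"
      using feet foot0_eq_iff [OF nd'(2)] by (metis add_left_cancel)
    moreover have "collinear {?F2, ?F3, ?F1}"
    proof -
      have "collinear {?F1, ?F2, ?F3}"
      proof -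
        have "cnj b * c * (b - a) * cnj (d - c) - b * cnj c * cnj (b - a) * (d - c) =
            (b * c - a * c) * (cnj b * cnj d - cnj a * cnj c)
            - (cnj b * cnj c - cnj a * cnj c) * (b * d - a * c)"
          by (simp add: algebra_simps)
        then show ?thesis unfolding T1 using eq eq' by simp
      qed
      then show ?thesis by (simp add: insert_commute)
    qed
    moreover have "collinear {?F2, ?F3, ?F4}"
    proof -
      have "cnj c * d * (c - b) * cnj (a - d) - c * cnj d * cnj (c - b) * (a - d) =
          (c * d - b * d) * (cnj c * cnj a - cnj b * cnj d)
          - (cnj c * cnj d - cnj b * cnj d) * (c * a - b * d)"
        by (simp add: algebra_simps)
      then show ?thesis unfolding T2 using eq eq' by (simp add: mult.commute)
    qed
    ultimately have "collinear (insert ?F2 (insert ?F3 {?F1, ?F4}))"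
      by (subst collinear_triples) auto
    then show "collinear {?F1, ?F2, ?F3, ?F4}"
      by (simp add: insert_commute)
  qed
  then show ?thesis by (simp add: defs)
qed

section \<open>Circumcircles and circles of similitude\<close>

lemma circumcircleI:
  assumes nc: "\<not> collinear {X, Y, Z}"
    and eq: "dist X Q = R" "dist Y Q = R" "dist Z Q = R"
  shows "circumcircle X Y Z = (Q, R)"
proof -
  have "circumcenter X Y Z = Q"
    unfolding circumcenter_def
  proof (rule the_equality)
    show "dist X Q = dist Y Q \<and> dist Y Q = dist Z Q"
      using eq by simp
  next
    fix Q' assume "dist X Q' = dist Y Q' \<and> dist Y Q' = dist Z Q'"
    moreover have "dist X Q = dist Y Q \<and> dist Y Q = dist Z Q"
      using eq by simp
    ultimately have h:
      "(cx X - cx Q') * cnj (cx X - cx Q') = (cx Y - cx Q') * cnj (cx Y - cx Q')"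
      "(cx Y - cx Q') * cnj (cx Y - cx Q') = (cx Z - cx Q') * cnj (cx Z - cx Q')"
      "(cx X - cx Q) * cnj (cx X - cx Q) = (cx Y - cx Q) * cnj (cx Y - cx Q)"
      "(cx Y - cx Q) * cnj (cx Y - cx Q) = (cx Z - cx Q) * cnj (cx Z - cx Q)"
      unfolding dist_cx cmod_eq_iff by auto
    define x y z p q where "x = cx X" and "y = cx Y" and "z = cx Z" and "p = cx Q'" and "q = cx Q"
    note h = h [folded x_def y_def z_def p_def q_def, unfolded complex_cnj_diff]
    have 1: "(y - x) * (cnj q - cnj p) + (cnj y - cnj x) * (q - p) = 0"
      using h(1,3) by algebra
    have 2: "(z - x) * (cnj q - cnj p) + (cnj z - cnj x) * (q - p) = 0"
      using h by algebra
    have "((y - x) * (cnj z - cnj x) - (cnj y - cnj x) * (z - x)) * (q - p) = 0"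
      using 1 2 by algebra
    then show "Q' = Q"
      using nc by (auto simp: collinear_cx x_def y_def z_def p_def q_def)
  qed
  then show ?thesis
    by (simp add: circumcircle_def circumradius_def eq)
qed

lemma circle_of_similitude_iff:
  assumes "R > 0" "R' > 0" "Q \<noteq> Q'"
  shows "Some P \<in> circle_of_similitude (Q, R) (Q', R') \<longleftrightarrow> dist P Q * R' = dist P Q' * R"
    and "None \<in> circle_of_similitude (Q, R) (Q', R') \<longleftrightarrow> R = R'"
proof -
  have "Some P \<in> circle_of_similitude (Q, R) (Q', R') \<longleftrightarrow> dist P Q / dist P Q' = R / R'"
    by (auto simp: circle_of_similitude_def)
  then show "Some P \<in> circle_of_similitude (Q, R) (Q', R') \<longleftrightarrow> dist P Q * R' = dist P Q' * R"
    using assms by (cases "P = Q'") (auto simp: field_simps)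
  show "None \<in> circle_of_similitude (Q, R) (Q', R') \<longleftrightarrow> R = R'"
    by (auto simp: circle_of_similitude_def)
qed

section \<open>Triangles inscribed in the unit circle\<close>

text \<open>For \<open>x\<close> and \<open>y\<close> on the unit circle this is the mirror image of \<open>a\<close> in the chord \<open>xy\<close>.\<close>

definition mirror :: "complex \<Rightarrow> complex \<Rightarrow> complex \<Rightarrow> complex" where
  "mirror a x y = x + y - x * y * cnj a"

text \<open>The classical equation \<open>a + z + b * c * d * cnj a * cnj z = b + c + d\<close> says that \<open>a\<close> and \<open>z\<close> are
  isogonal conjugates in the triangle \<open>bcd\<close> inscribed in the unit circle. The failure of this
  equation is kept as a quantity because the circles of similitude are expressed through it.\<close>

definition isogonal_defect :: "complex \<Rightarrow> complex \<Rightarrow> complex \<Rightarrow> complex \<Rightarrow> complex \<Rightarrow> complex" where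
  "isogonal_defect b c d a z = a + z + b * c * d * cnj a * cnj z - (b + c + d)"

text \<open>On the unit circle conjugation is inversion, which turns identities involving conjugates
  into identities of rational functions.\<close>

lemma unit_cnj: "x * cnj x = 1 \<Longrightarrow> x \<noteq> 0 \<and> cnj x = 1 / x" for x :: complex
  by (metis div_by_0 mult_zero_left nonzero_mult_div_cancel_left zero_neq_one)

text \<open>The points equidistant from the mirror images of \<open>a\<close> in two sides form a line through the
  common vertex \<open>x\<close> of the sides. Its equation differs from one vertex to another only by the
  factor \<open>x\<close> on the left, so on two of the three lines the defect must vanish.\<close>

lemma equidistant_from_mirrors_iff:
  assumes "x * cnj x = 1" "y * cnj y = 1" "u * cnj u = 1" "y \<noteq> u"
  shows "cmod (z - mirror a x y) = cmod (z - mirror a x u) \<longleftrightarrow>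
    x * isogonal_defect x y u a z = x * y * u * cnj (isogonal_defect x y u a z)"
proof -
  note unit = assms(1-3) [THEN unit_cnj]
  note nz = unit [THEN conjunct1] and cnj_eq = unit [THEN conjunct2]
  have "x * y * u * ((z - mirror a x y) * cnj (z - mirror a x y)
        - (z - mirror a x u) * cnj (z - mirror a x u)) =
      (y - u) * (x * isogonal_defect x y u a z - x * y * u * cnj (isogonal_defect x y u a z))"
    unfolding isogonal_defect_def mirror_def
    by (simp add: cnj_eq) (simp add: nz field_simps)
  moreover have "x * y * u \<noteq> 0" "y - u \<noteq> 0"
    using nz assms(4) by auto
  ultimately show ?thesis
    unfolding cmod_eq_iff by (metis eq_iff_diff_eq_0 mult_eq_0_iff)
qed

lemma mirror_commute: "mirror a x y = mirror a y x"
  by (simp add: mirror_def algebra_simps)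

text \<open>The decisive factorisation. The locus \<open>cmod (z - mirror a b d) = cmod (1 - cnj a * z)\<close> is the
  inverted circle of similitude of \<open>(DAB)\<close> and \<open>(BCD)\<close>, and the assumption \<open>line\<close> describes the one
  of \<open>(ABC)\<close> and \<open>(CDA)\<close>. Modulo the equation of this line the equation of the circle is a product
  of the defect and a linear factor.\<close>

lemma equidistant_on_line_24_iff:
  assumes "b * cnj b = 1" "c * cnj c = 1" "d * cnj d = 1"
    and line: "c * isogonal_defect b c d a z = b * c * d * cnj (isogonal_defect b c d a z)"
  shows "cmod (z - mirror a b d) = cmod (1 - cnj a * z) \<longleftrightarrow>
    isogonal_defect b c d a z = 0 \<or> (z - c) * (a - c) = (b - c) * (d - c)"
proof -
  note unit = assms(1-3) [THEN unit_cnj]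
  note nz = unit [THEN conjunct1] and cnj_eq = unit [THEN conjunct2]
  have "b * c * d * ((z - mirror a b d) * cnj (z - mirror a b d)
        - (1 - cnj a * z) * cnj (1 - cnj a * z)) =
      (b * c * d * cnj (isogonal_defect b c d a z) - c * isogonal_defect b c d a z) * (z + a - b - d)
      - isogonal_defect b c d a z * ((z - c) * (a - c) - (b - c) * (d - c))"
    unfolding isogonal_defect_def mirror_def
    by (simp add: cnj_eq) (simp add: nz field_simps)
  then show ?thesis
    unfolding cmod_eq_iff using unit line by auto
qed

text \<open>The equation and its conjugate are two linear equations in \<open>z\<close> and \<open>cnj z\<close>, whose determinant
  \<open>1 - a * cnj a\<close> is nonzero because \<open>a\<close> is not on the circumcircle.\<close>

lemma ex1_isogonal_conjugate:
  assumes "b * cnj b = 1" "c * cnj c = 1" "d * cnj d = 1" "a * cnj a \<noteq> 1"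
  shows "\<exists>!z. isogonal_defect b c d a z = 0"
proof -
  define k where "k = b * c * d"
  have k: "k * cnj k = 1"
    using arg_cong2 [OF assms(1) arg_cong2 [OF assms(2,3), of "(*)"], of "(*)"]
    by (simp add: k_def mult_ac)
  define s where "s = b + c + d"
  define w where "w = (s - a - k * cnj a * (cnj s - cnj a)) / (1 - a * cnj a)"
  have ne: "1 - a * cnj a \<noteq> 0"
    using assms(4) by auto
  have w1: "(1 - a * cnj a) * w = s - a - k * cnj a * (cnj s - cnj a)"
    using ne by (simp add: w_def)
  have w2: "(1 - a * cnj a) * cnj w = cnj s - cnj a - cnj k * a * (s - a)"
    using arg_cong [OF w1, of cnj] by (simp add: mult_ac)
  have "(1 - a * cnj a) * (a + w + k * cnj a * cnj w - s) = 0"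
    using w1 w2 k by algebra
  then have "isogonal_defect b c d a w = 0"
    using ne by (simp add: isogonal_defect_def k_def s_def)
  moreover have "z = w" if "isogonal_defect b c d a z = 0" for z
  proof -
    have "a + z + k * cnj a * cnj z = s" "a + w + k * cnj a * cnj w = s"
      using that \<open>isogonal_defect b c d a w = 0\<close> by (simp_all add: isogonal_defect_def k_def s_def)
    then have "z + k * cnj a * cnj z = w + k * cnj a * cnj w"
      by (metis add.assoc add_left_cancel)
    then have 1: "z - w = - (k * cnj a * cnj (z - w))"
      by (simp add: algebra_simps)
    have 2: "cnj (z - w) = - (cnj k * a * (z - w))"
      using arg_cong [OF 1, of cnj] by (simp only: complex_cnj_minus complex_cnj_mult complex_cnj_cnj)
    have "(1 - a * cnj a) * (z - w) = 0"
      using 1 2 k by algebra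
    then show "z = w" using ne by auto
  qed
  ultimately show ?thesis by blast
qed

section \<open>The noncyclic quadrilateral after an inversion\<close>

text \<open>The plane is described by the coordinate \<open>z\<close> for which the point has coordinate
  \<open>cx A + k / (z - a)\<close>. This is an inversion at \<open>A\<close> composed with a reflection and a similarity, chosen
  such that \<open>B\<close>, \<open>C\<close>, \<open>D\<close> go to points \<open>b\<close>, \<open>c\<close>, \<open>d\<close> of the unit circle.\<close>

locale inverted_quadrilateral =
  fixes A B C D :: point and a b c d k :: complex
  assumes unit: "b * cnj b = 1" "c * cnj c = 1" "d * cnj d = 1"
    and off: "a * cnj a \<noteq> 1"
    and k: "k \<noteq> 0"
    and B: "cx B = cx A + k / (b - a)"
    and C: "cx C = cx A + k / (c - a)"
    and D: "cx D = cx A + k / (d - a)"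
    and nd: "\<not> collinear {A, B, C}" "\<not> collinear {B, C, D}"
      "\<not> collinear {C, D, A}" "\<not> collinear {D, A, B}"
    and noncyclic: "\<not> cyclic_quadrilateral A B C D"
begin

lemma distinct: "b \<noteq> c" "c \<noteq> d" "d \<noteq> b"
proof -
  have "B \<noteq> C" "C \<noteq> D" "D \<noteq> B"
    using nd(2) by (auto simp: insert_commute)
  then show "b \<noteq> c" "c \<noteq> d" "d \<noteq> b"
    using B C D cx_eq_iff by metis+
qed

lemma a_neq: "b \<noteq> a" "c \<noteq> a" "d \<noteq> a"
  using unit off by auto

text \<open>The pole \<open>a\<close> of the coordinate stands for the point at infinity. Thus the completed plane
  without \<open>A\<close> corresponds exactly to the complex numbers.\<close>

definition at_coord :: "complex \<Rightarrow> ext_point" where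
  "at_coord z = (if z = a then None else Some (pt (cx A + k / (z - a))))"

lemma at_coord_exhaust: "T = Some A \<or> (\<exists>z. T = at_coord z)"
proof (cases T)
  case None
  then show ?thesis by (auto simp: at_coord_def)
next
  case (Some P)
  show ?thesis
  proof (cases "P = A")
    case False
    then have "cx P - cx A \<noteq> 0" by simp
    then have "T = at_coord (a + k / (cx P - cx A))"
      using k Some by (auto simp: at_coord_def simp flip: cx_eq_iff)
    then show ?thesis by blast
  qed (use Some in simp)
qed

lemma at_coord_neq: "at_coord z \<noteq> Some A"
  using k by (auto simp: at_coord_def simp flip: cx_eq_iff)

lemma at_coord_eq_iff: "at_coord z = Some P \<longleftrightarrow> (cx P - cx A) * (z - a) = k"
proof (cases "z = a")
  case False
  then have "at_coord z = Some P \<longleftrightarrow> cx A + k / (z - a) = cx P"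
    by (auto simp: at_coord_def simp flip: cx_eq_iff)
  also have "\<dots> \<longleftrightarrow> (cx P - cx A) * (z - a) = k"
    using False by (auto simp: field_simps)
  finally show ?thesis .
qed (use k in \<open>auto simp: at_coord_def\<close>)

text \<open>Center and radius scaled by \<open>k\<close>, so that \<open>k\<close> cancels from all conditions of similitude.\<close>

definition circ :: "complex \<Rightarrow> real \<Rightarrow> circle" where
  "circ v r = (pt (cx A + k * v), cmod k * r)"

text \<open>Multiplying the distances by \<open>cmod (z - a)\<close> removes the denominators. At \<open>z = a\<close> the resulting
  condition reduces to equality of the radii, which is the rule for the point at infinity.\<close>

lemma similitude_circ:
  assumes "r > 0" "s > 0" "v \<noteq> w"
  shows "at_coord z \<in> circle_of_similitude (circ v r) (circ w s) \<longleftrightarrow>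
      cmod (1 - v * (z - a)) * s = cmod (1 - w * (z - a)) * r"
    and "Some A \<in> circle_of_similitude (circ v r) (circ w s) \<longleftrightarrow> cmod v * s = cmod w * r"
proof -
  have pos: "cmod k * r > 0" "cmod k * s > 0"
    and ne: "pt (cx A + k * v) \<noteq> pt (cx A + k * w)"
    using assms k by (auto simp flip: cx_eq_iff)
  note iff = circle_of_similitude_iff [OF pos ne]
  show "at_coord z \<in> circle_of_similitude (circ v r) (circ w s) \<longleftrightarrow>
      cmod (1 - v * (z - a)) * s = cmod (1 - w * (z - a)) * r"
  proof (cases "z = a")
    case True
    then show ?thesis
      using iff(2) k by (auto simp: circ_def at_coord_def)
  next
    case False
    have dist: "dist (pt (cx A + k / (z - a))) (pt (cx A + k * u)) =
        cmod k / cmod (z - a) * cmod (1 - u * (z - a))" for u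
    proof -
      have "k / (z - a) - k * u = k / (z - a) * (1 - u * (z - a))"
        using False by (simp add: field_simps)
      then show ?thesis
        by (simp add: dist_cx norm_mult norm_divide del: right_diff_distrib)
    qed
    have "at_coord z \<in> circle_of_similitude (circ v r) (circ w s) \<longleftrightarrow>
        cmod k / cmod (z - a) * cmod (1 - v * (z - a)) * (cmod k * s) =
        cmod k / cmod (z - a) * cmod (1 - w * (z - a)) * (cmod k * r)"
      using False by (simp add: at_coord_def circ_def iff dist)
    also have "\<dots> \<longleftrightarrow> cmod (1 - v * (z - a)) * s = cmod (1 - w * (z - a)) * r"
      using False k by (simp add: field_simps)
    finally show ?thesis .
  qed
  have "Some A \<in> circle_of_similitude (circ v r) (circ w s) \<longleftrightarrow>
      cmod k * cmod v * (cmod k * s) = cmod k * cmod w * (cmod k * r)"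
    by (simp add: circ_def iff dist_cx norm_mult)
  then show "Some A \<in> circle_of_similitude (circ v r) (circ w s) \<longleftrightarrow> cmod v * s = cmod w * r"
    using k by (simp add: field_simps)
qed

text \<open>If \<open>a\<close> were its own mirror image, it would lie on the line \<open>xy\<close>, and inversion at \<open>A\<close> would
  map this line to a line through \<open>A\<close> that contains \<open>X\<close> and \<open>Y\<close>.\<close>

lemma mirror_neq:
  assumes "x * cnj x = 1" "y * cnj y = 1"
    and "cx X = cx A + k / (x - a)" "cx Y = cx A + k / (y - a)"
    and "\<not> collinear {A, X, Y}"
  shows "mirror a x y \<noteq> a"
proof
  assume eq: "mirror a x y = a"
  note ux = assms(1) [THEN unit_cnj] and uy = assms(2) [THEN unit_cnj]
  have ne: "x - a \<noteq> 0" "y - a \<noteq> 0"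
    using assms(1,2) off by auto
  then have ne': "cnj x - cnj a \<noteq> 0" "cnj y - cnj a \<noteq> 0"
    by auto
  have "(cnj x - cnj a) * (y - a) = (x - a) * (cnj y - cnj a)"
  proof -
    have "a = x + y - x * y * cnj a"
      using eq by (simp add: mirror_def)
    then have "y - a = - (x * (1 - y * cnj a))" and "x - a = - (y * (1 - x * cnj a))"
      by algebra+
    then have "(cnj x - cnj a) * (y - a) = - ((x * cnj x - x * cnj a) * (1 - y * cnj a))"
        "(x - a) * (cnj y - cnj a) = - ((y * cnj y - y * cnj a) * (1 - x * cnj a))"
      by algebra+
    then show ?thesis using assms(1,2) by simp
  qed
  then have "collinear {A, X, Y}"
    unfolding collinear_cx assms(3,4) using ne ne' by (simp add: divide_simps)
  then show False using assms(5) by blast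
qed

text \<open>The line \<open>xy\<close> of the inverted picture corresponds to the circle through \<open>A\<close>, \<open>X\<close>, \<open>Y\<close>, and
  the mirror image of \<open>a\<close> in this line corresponds to the center of this circle.\<close>

lemma circumcircle_through_A:
  assumes "x * cnj x = 1" "y * cnj y = 1"
    and "cx X = cx A + k / (x - a)" "cx Y = cx A + k / (y - a)"
    and "\<not> collinear {A, X, Y}"
    and P: "{P, Q, R} = {A, X, Y}"
  shows "circumcircle P Q R = circ (1 / (mirror a x y - a)) (1 / cmod (mirror a x y - a))"
proof -
  define m where "m = mirror a x y"
  have m: "m - a \<noteq> 0"
    using mirror_neq [OF assms(1-5)] by (simp add: m_def)
  have ne: "x - a \<noteq> 0" "y - a \<noteq> 0"
    using assms(1,2) off by auto
  have mx: "cmod (m - x) = cmod (x - a)" and my: "cmod (m - y) = cmod (y - a)"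
    unfolding cmod_eq_iff m_def mirror_def using assms(1,2) by simp_all algebra+
  let ?O = "pt (cx A + k / (m - a))" and ?r = "cmod k / cmod (m - a)"
  have *: "cmod (k / (u - a) - k / (m - a)) = ?r" if "cmod (m - u) = cmod (u - a)" "u - a \<noteq> 0" for u
  proof -
    have "k / (u - a) - k / (m - a) = k * (m - u) / ((u - a) * (m - a))"
      using m that by (simp add: field_simps)
    then show ?thesis
      using that by (simp add: norm_mult norm_divide)
  qed
  have "dist T ?O = ?r" if "T \<in> {A, X, Y}" for T
    using that * [OF mx ne(1)] * [OF my ne(2)]
    by (auto simp: dist_cx assms(3,4) norm_divide)
  then have "circumcircle P Q R = (?O, ?r)"
    using assms(5) P by (intro circumcircleI) auto
  then show ?thesis
    by (simp add: circ_def m_def)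
qed

text \<open>The circle \<open>(BCD)\<close> corresponds to the unit circle; its center corresponds to the inverse
  \<open>1 / cnj a\<close> of \<open>a\<close>. The formula for the center also makes sense for \<open>a = 0\<close>, when \<open>A\<close> is the
  center.\<close>

lemma circumcircle_opposite_A:
  "circumcircle B C D = circ (- cnj a / (a * cnj a - 1)) (1 / cmod (a * cnj a - 1))"
proof -
  define e where "e = a * cnj a - 1"
  have e: "e \<noteq> 0" using off by (simp add: e_def)
  let ?O = "pt (cx A + k * (- cnj a / e))" and ?r = "cmod k * (1 / cmod e)"
  have *: "cmod (k / (x - a) - k * (- cnj a / e)) = ?r" if "x * cnj x = 1" for x
  proof -
    have ne: "x - a \<noteq> 0"
      using that off by auto
    have "k / (x - a) - k * (- cnj a / e) = k * ((e + cnj a * (x - a)) / ((x - a) * e))"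
      using ne e by (simp add: field_simps)
    moreover have "cmod (e + cnj a * (x - a)) = cmod (x - a)"
      unfolding cmod_eq_iff e_def using that by simp algebra
    ultimately show ?thesis
      using ne by (simp add: norm_mult norm_divide)
  qed
  have "dist T ?O = ?r" if "T \<in> {B, C, D}" for T
    using that unit * by (auto simp: dist_cx B C D)
  then have "circumcircle B C D = (?O, ?r)"
    using nd by (intro circumcircleI) auto
  then show ?thesis
    by (simp add: circ_def e_def)
qed

text \<open>For two circles through \<open>A\<close>, the circle of similitude becomes the perpendicular bisector of
  the two points that correspond to the centers.\<close>

lemma similitude_through_A:
  assumes "m \<noteq> a" "n \<noteq> a" "m \<noteq> n"
  shows "at_coord z \<in> circle_of_similitude (circ (1 / (m - a)) (1 / cmod (m - a)))
      (circ (1 / (n - a)) (1 / cmod (n - a))) \<longleftrightarrow> cmod (z - m) = cmod (z - n)"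
proof -
  have *: "cmod (1 - 1 / (m - a) * (z - a)) = cmod (z - m) / cmod (m - a)" if "m \<noteq> a" for m
  proof -
    have "1 - 1 / (m - a) * (z - a) = (m - z) / (m - a)"
      using that by (simp add: field_simps)
    then show ?thesis
      by (simp add: norm_divide norm_minus_commute)
  qed
  show ?thesis
    using assms by (subst similitude_circ)
      (auto simp: * mult.commute [of "cmod (n - a)"] simp del: times_divide_eq_left mult_1_left)
qed

lemma mirror_diff:
  assumes "x * cnj x = 1" "y \<noteq> u"
  shows "mirror a x y \<noteq> mirror a x u"
proof
  assume "mirror a x y = mirror a x u"
  then have "(y - u) * (1 - x * cnj a) = 0"
    by (simp add: mirror_def algebra_simps)
  then have "x * cnj a = 1"
    using assms(2) by auto
  then have "x * (cnj a - cnj x) = 0"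
    using assms(1) by (simp add: algebra_simps)
  then have "a = x"
    using assms(1) by auto
  then show False
    using off assms(1) by simp
qed

lemma circles:
  "circumcircle D A B = circ (1 / (mirror a b d - a)) (1 / cmod (mirror a b d - a))"
  "circumcircle A B C = circ (1 / (mirror a b c - a)) (1 / cmod (mirror a b c - a))"
  "circumcircle C D A = circ (1 / (mirror a c d - a)) (1 / cmod (mirror a c d - a))"
  by (rule circumcircle_through_A [OF _ _ B D] circumcircle_through_A [OF _ _ B C]
      circumcircle_through_A [OF _ _ C D]; use unit nd in \<open>auto simp: insert_commute\<close>)+

lemma mirrors_neq_a: "mirror a b d \<noteq> a" "mirror a b c \<noteq> a" "mirror a c d \<noteq> a"
  by (rule mirror_neq [OF _ _ B D] mirror_neq [OF _ _ B C] mirror_neq [OF _ _ C D];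
      use unit nd in \<open>auto simp: insert_commute\<close>)+

abbreviation defect :: "complex \<Rightarrow> complex" where
  "defect z \<equiv> isogonal_defect b c d a z"

lemma similitude_12:
  "at_coord z \<in> circle_of_similitude (circumcircle D A B) (circumcircle A B C) \<longleftrightarrow>
    b * defect z = b * c * d * cnj (defect z)"
proof -
  have "cmod (z - mirror a b d) = cmod (z - mirror a b c) \<longleftrightarrow>
      b * isogonal_defect b d c a z = b * d * c * cnj (isogonal_defect b d c a z)"
    using unit distinct by (intro equidistant_from_mirrors_iff) auto
  also have "isogonal_defect b d c a z = defect z"
    by (simp add: isogonal_defect_def algebra_simps)
  finally show ?thesis
    using unit distinct unfolding circles
    by (subst similitude_through_A) (auto simp: mirrors_neq_a mirror_diff mult_ac)
qed

lemma similitude_14: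
  "at_coord z \<in> circle_of_similitude (circumcircle D A B) (circumcircle C D A) \<longleftrightarrow>
    d * defect z = b * c * d * cnj (defect z)"
proof -
  have "cmod (z - mirror a d b) = cmod (z - mirror a d c) \<longleftrightarrow>
      d * isogonal_defect d b c a z = d * b * c * cnj (isogonal_defect d b c a z)"
    using unit distinct by (intro equidistant_from_mirrors_iff) auto
  also have "isogonal_defect d b c a z = defect z"
    by (simp add: isogonal_defect_def algebra_simps)
  finally have *: "cmod (z - mirror a b d) = cmod (z - mirror a c d) \<longleftrightarrow>
      d * defect z = b * c * d * cnj (defect z)"
    by (simp add: mirror_commute mult_ac)
  have "mirror a b d \<noteq> mirror a c d"
    using mirror_diff [of d b c] unit distinct by (simp add: mirror_commute)
  then show ?thesis
    using * unfolding circles by (subst similitude_through_A) (auto simp: mirrors_neq_a)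
qed

lemma similitude_24:
  "at_coord z \<in> circle_of_similitude (circumcircle A B C) (circumcircle C D A) \<longleftrightarrow>
    c * defect z = b * c * d * cnj (defect z)"
proof -
  have "cmod (z - mirror a c b) = cmod (z - mirror a c d) \<longleftrightarrow>
      c * isogonal_defect c b d a z = c * b * d * cnj (isogonal_defect c b d a z)"
    using unit distinct by (intro equidistant_from_mirrors_iff) auto
  also have "isogonal_defect c b d a z = defect z"
    by (simp add: isogonal_defect_def algebra_simps)
  finally have *: "cmod (z - mirror a b c) = cmod (z - mirror a c d) \<longleftrightarrow>
      c * defect z = b * c * d * cnj (defect z)"
    by (simp add: mirror_commute mult_ac)
  have "mirror a b c \<noteq> mirror a c d"
    using mirror_diff [of c b d] unit distinct by (simp add: mirror_commute)
  then show ?thesis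
    using * unfolding circles by (subst similitude_through_A) (auto simp: mirrors_neq_a)
qed

text \<open>The circle \<open>(BCD)\<close> does not pass through \<open>A\<close>, so its circle of similitude with \<open>(DAB)\<close> remains
  a circle and avoids \<open>A\<close>.\<close>

lemma similitude_13:
  "at_coord z \<in> circle_of_similitude (circumcircle D A B) (circumcircle B C D) \<longleftrightarrow>
    cmod (z - mirror a b d) = cmod (1 - cnj a * z)"
  and A_notin_similitude_13:
  "Some A \<notin> circle_of_similitude (circumcircle D A B) (circumcircle B C D)"
proof -
  define m e where "m = mirror a b d - a" and "e = a * cnj a - 1"
  have m: "m \<noteq> 0" and e: "e \<noteq> 0"
    using mirrors_neq_a off by (auto simp: m_def e_def)
  have "e + m * cnj a = (b * cnj a - 1) * (1 - d * cnj a)"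
    by (simp add: e_def m_def mirror_def algebra_simps)
  moreover have "x * cnj a \<noteq> 1" if "x * cnj x = 1" for x
  proof
    assume "x * cnj a = 1"
    then have "x * (cnj a - cnj x) = 0"
      using that by (simp add: algebra_simps)
    then have "a = x"
      using that by auto
    then show False
      using off that by simp
  qed
  ultimately have "e + m * cnj a \<noteq> 0"
    using unit by auto
  have pos: "1 / cmod m > 0" "1 / cmod e > 0"
    using m e by simp_all
  have ne: "1 / m \<noteq> - cnj a / e"
  proof
    assume "1 / m = - cnj a / e"
    moreover have "e + m * cnj a = m * e * (1 / m - - cnj a / e)"
      using m e by (simp add: field_simps)
    ultimately show False
      using \<open>e + m * cnj a \<noteq> 0\<close> by simp
  qed
  have 1: "cmod (1 - 1 / m * (z - a)) = cmod (z - mirror a b d) / cmod m"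
  proof -
    have "1 - 1 / m * (z - a) = (mirror a b d - z) / m"
      using m by (simp add: field_simps m_def)
    then show ?thesis
      by (simp add: norm_divide norm_minus_commute)
  qed
  have 2: "cmod (1 - - cnj a / e * (z - a)) = cmod (1 - cnj a * z) / cmod e"
  proof -
    have "1 - - cnj a / e * (z - a) = (cnj a * z - 1) / e"
      using e by (simp add: field_simps) (simp add: e_def algebra_simps)
    then show ?thesis
      by (simp add: norm_divide norm_minus_commute)
  qed
  have "x / p * (1 / q) = y / q * (1 / p) \<longleftrightarrow> x = y" if "p \<noteq> 0" "q \<noteq> 0" for x y p q :: real
    using that by (simp add: field_simps)
  then show "at_coord z \<in> circle_of_similitude (circumcircle D A B) (circumcircle B C D) \<longleftrightarrow>
      cmod (z - mirror a b d) = cmod (1 - cnj a * z)"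
    unfolding circles circumcircle_opposite_A m_def [symmetric] e_def [symmetric]
      similitude_circ(1) [OF pos ne] 1 2
    using m e by simp
  have "cmod a \<noteq> 1"
    using off cmod_eq_iff [of a 1] by simp
  then show "Some A \<notin> circle_of_similitude (circumcircle D A B) (circumcircle B C D)"
    unfolding circles circumcircle_opposite_A m_def [symmetric] e_def [symmetric]
      similitude_circ(2) [OF pos ne]
    using m e by (simp add: norm_divide mult.commute [of "cmod m"])
qed

text \<open>The isoptic point corresponds to the isogonal conjugate of \<open>a\<close>: the equations of two different
  bisectors together force the defect to vanish.\<close>

lemma isoptic_point_eq:
  assumes w: "defect w = 0"
  shows "isoptic_point A B C D = at_coord w"
proof -
  have unique: "z = w"
    if "b * defect z = b * c * d * cnj (defect z)" "d * defect z = b * c * d * cnj (defect z)" for z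
  proof -
    have "(b - d) * defect z = 0"
      unfolding left_diff_distrib that by (rule right_minus_eq [THEN iffD2, OF refl])
    then have "defect z = 0"
      using distinct by auto
    then show "z = w"
      using w ex1_isogonal_conjugate [OF unit off] by metis
  qed
  have "(THE W. W \<in> circle_of_similitude (circumcircle D A B) (circumcircle A B C) \<and>
      W \<in> circle_of_similitude (circumcircle D A B) (circumcircle C D A) \<and>
      W \<noteq> Some A) = at_coord w"
  proof (rule the_equality)
    show "at_coord w \<in> circle_of_similitude (circumcircle D A B) (circumcircle A B C) \<and>
        at_coord w \<in> circle_of_similitude (circumcircle D A B) (circumcircle C D A) \<and>
        at_coord w \<noteq> Some A"
      unfolding similitude_12 similitude_14 w by (simp add: at_coord_neq)
  next
    fix T
    assume T: "T \<in> circle_of_similitude (circumcircle D A B) (circumcircle A B C) \<and>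
        T \<in> circle_of_similitude (circumcircle D A B) (circumcircle C D A) \<and> T \<noteq> Some A"
    then obtain z where z: "T = at_coord z"
      using at_coord_exhaust by blast
    show "T = at_coord w"
      using T unique [of z] unfolding z similitude_12 similitude_14 by blast
  qed
  then show ?thesis
    unfolding isoptic_point_def using noncyclic by (simp only: if_False)
qed

text \<open>Both points \<open>w\<close> and \<open>s\<close> lie on the line that corresponds to the second circle of similitude, and
  on this line the factorisation leaves no other solution. If \<open>w\<close> and \<open>s\<close> coincide, the intersection
  is a singleton, and \<open>{W, S} = {W}\<close> still determines \<open>S\<close>.\<close>

lemma simson_point_eq:
  assumes s: "(s - c) * (a - c) = (b - c) * (d - c)"
  shows "simson_point A B C D = at_coord s"
proof -
  let ?CS13 = "circle_of_similitude (circumcircle D A B) (circumcircle B C D)"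
  let ?CS24 = "circle_of_similitude (circumcircle A B C) (circumcircle C D A)"
  obtain w where w: "defect w = 0" and unique: "\<forall>z. defect z = 0 \<longrightarrow> z = w"
    using ex1_isogonal_conjugate [OF unit off] unfolding Ex1_def by (elim exE conjE)
  have mem: "at_coord z \<in> ?CS13 \<inter> ?CS24 \<longleftrightarrow> z = w \<or> z = s" for z
  proof -
    \<comment> \<open>The defining equation of \<open>s\<close> and its conjugate are linear in \<open>s\<close> and \<open>cnj s\<close>; the equation
      of the line is a combination of the two.\<close>
    have line_s: "c * defect s = b * c * d * cnj (defect s)"
    proof -
      note u = unit [THEN unit_cnj]
      note nz = u [THEN conjunct1] and cnj_eq = u [THEN conjunct2]
      have Y: "b * c * d * cnj (defect s) = a * s + b * c * d * (cnj s + cnj a) - (b * c + c * d + d * b)"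
        by (simp add: isogonal_defect_def cnj_eq) (simp add: nz field_simps)
      have "b * d * c * (cnj s - cnj c) * (c * cnj a - c * cnj c) =
          b * d * c * c * cnj ((s - c) * (a - c))"
        by (simp add: algebra_simps)
      also have "\<dots> = b * d * c * c * cnj ((b - c) * (d - c))"
        unfolding s ..
      also have "\<dots> = (b - c) * (d - c)"
        by (simp add: cnj_eq) (simp add: nz field_simps)
      finally have s': "b * d * c * (cnj s - cnj c) * (c * cnj a - 1) = (b - c) * (d - c)"
        unfolding unit .
      have "c * defect s - (a * s + b * c * d * (cnj s + cnj a) - (b * c + c * d + d * b)) =
          - ((s - c) * (a - c) - (b - c) * (d - c))
          + (b * d * c * (cnj s - cnj c) * (c * cnj a - 1) - (b - c) * (d - c))
          + b * d * (c * cnj a - 1) * (c * cnj c - 1)"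
        by (simp add: isogonal_defect_def algebra_simps)
      also have "\<dots> = 0"
        unfolding s s' unit by simp
      finally show ?thesis
        unfolding Y by (simp only: right_minus_eq)
    qed
    have line_w: "c * defect w = b * c * d * cnj (defect w)"
      using w by simp
    have s_iff: "(z - c) * (a - c) = (b - c) * (d - c) \<longleftrightarrow> z = s"
      unfolding s [symmetric] using a_neq by simp
    have w_iff: "defect z = 0 \<longleftrightarrow> z = w"
    proof
      show "defect z = 0 \<Longrightarrow> z = w"
        by (rule unique [rule_format])
      show "z = w \<Longrightarrow> defect z = 0"
        by (simp only: w)
    qed
    have key: "cmod (z - mirror a b d) = cmod (1 - cnj a * z) \<longleftrightarrow> z = w \<or> z = s"
      if "c * defect z = b * c * d * cnj (defect z)"
      using equidistant_on_line_24_iff [OF unit that] unfolding s_iff w_iff .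
    show ?thesis
      unfolding Int_iff similitude_13 similitude_24
    proof (intro iffI)
      assume "cmod (z - mirror a b d) = cmod (1 - cnj a * z) \<and> c * defect z = b * c * d * cnj (defect z)"
      then show "z = w \<or> z = s"
        using key by (elim conjE) (rule iffD1)
    next
      assume zws: "z = w \<or> z = s"
      then have line_z: "c * defect z = b * c * d * cnj (defect z)"
      proof
        assume "z = w" then show ?thesis by (simp only: line_w)
      next
        assume "z = s" then show ?thesis by (simp only: line_s)
      qed
      show "cmod (z - mirror a b d) = cmod (1 - cnj a * z) \<and> c * defect z = b * c * d * cnj (defect z)"
        by (intro conjI key [OF line_z, THEN iffD2] zws line_z)
    qed
  qed
  have "?CS13 \<inter> ?CS24 = {at_coord w, at_coord s}"
  proof (intro subset_antisym subsetI)
    fix T assume T: "T \<in> ?CS13 \<inter> ?CS24"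
    then obtain z where z: "T = at_coord z"
      using at_coord_exhaust [of T] A_notin_similitude_13 by blast
    have "z = w \<or> z = s"
      using T unfolding z mem .
    then show "T \<in> {at_coord w, at_coord s}"
      unfolding z by auto
  next
    fix T assume "T \<in> {at_coord w, at_coord s}"
    then obtain z where "T = at_coord z" "z = w \<or> z = s"
      by auto
    then show "T \<in> ?CS13 \<inter> ?CS24"
      by (simp only: mem)
  qed
  moreover have "{at_coord w, at_coord s} = {at_coord w, T} \<longleftrightarrow> T = at_coord s" for T
    by (auto simp only: doubleton_eq_iff)
  ultimately have "(THE S. ?CS13 \<inter> ?CS24 = {isoptic_point A B C D, S}) = at_coord s"
    unfolding isoptic_point_eq [OF w] by (simp only: the_eq_trivial)
  then show ?thesis
    unfolding simson_point_def by (simp only: noncyclic if_False)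
qed

text \<open>The equation that defines \<open>s\<close>, rewritten for the original coordinates.\<close>

lemma simson_point_iff:
  "Some P = simson_point A B C D \<longleftrightarrow>
    (cx A - cx P) * (cx C - cx P) = (cx B - cx P) * (cx D - cx P)"
proof -
  define s where "s = c + (b - c) * (d - c) / (a - c)"
  have s: "(s - c) * (a - c) = (b - c) * (d - c)"
    using a_neq by (simp add: s_def)
  define p where "p = cx P - cx A"
  define \<beta> \<gamma> \<delta> where "\<beta> = b - a" and "\<gamma> = c - a" and "\<delta> = d - a"
  have ne: "\<beta> \<noteq> 0" "\<gamma> \<noteq> 0" "\<delta> \<noteq> 0"
    using a_neq by (simp_all add: \<beta>_def \<gamma>_def \<delta>_def)
  have sa: "(s - a) * \<gamma> = \<gamma> * (\<beta> + \<delta>) - \<beta> * \<delta>"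
    using s unfolding \<beta>_def \<gamma>_def \<delta>_def by algebra
  have "Some P = simson_point A B C D \<longleftrightarrow> p * (s - a) = k"
    unfolding simson_point_eq [OF s] p_def at_coord_eq_iff [symmetric] by (rule eq_commute)
  also have "\<dots> \<longleftrightarrow> p * ((s - a) * \<gamma>) = k * \<gamma>"
    using ne by auto
  also have "\<dots> \<longleftrightarrow> - p * (k / \<gamma> - p) = (k / \<beta> - p) * (k / \<delta> - p)"
    unfolding sa
  proof -
    have "((k / \<beta> - p) * (k / \<delta> - p) + p * (k / \<gamma> - p)) * (\<beta> * \<gamma> * \<delta>) =
        k * (k * \<gamma> - p * (\<gamma> * (\<beta> + \<delta>) - \<beta> * \<delta>))"
      using ne by (simp add: field_simps)
    moreover have "\<beta> * \<gamma> * \<delta> \<noteq> 0"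
      using ne by simp
    ultimately have "(k / \<beta> - p) * (k / \<delta> - p) - - p * (k / \<gamma> - p) = 0 \<longleftrightarrow>
        k * \<gamma> - p * (\<gamma> * (\<beta> + \<delta>) - \<beta> * \<delta>) = 0"
      using k by (metis (no_types, lifting) mult_eq_0_iff minus_mult_left diff_minus_eq_add)
    then show "p * (\<gamma> * (\<beta> + \<delta>) - \<beta> * \<delta>) = k * \<gamma> \<longleftrightarrow>
        - p * (k / \<gamma> - p) = (k / \<beta> - p) * (k / \<delta> - p)"
      unfolding right_minus_eq by metis
  qed
  also have "\<dots> \<longleftrightarrow> (cx A - cx P) * (cx C - cx P) = (cx B - cx P) * (cx D - cx P)"
    unfolding B C D \<beta>_def [symmetric] \<gamma>_def [symmetric] \<delta>_def [symmetric]
    by (simp add: p_def algebra_simps)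
  finally show ?thesis .
qed

end

section \<open>The Simson point of a noncyclic quadrilateral\<close>

text \<open>It remains to construct the coordinate. The images of \<open>B\<close>, \<open>C\<close>, \<open>D\<close> under \<open>1 / x\<close> lie on a
  circle, because the circumcircle of \<open>BCD\<close> avoids \<open>A\<close>; the constants \<open>a\<close> and \<open>k\<close> below move
  this circle to the unit circle.\<close>

lemma simson_point_noncyclic_iff:
  assumes nd: "\<not> collinear {A, B, C}" "\<not> collinear {B, C, D}"
      "\<not> collinear {C, D, A}" "\<not> collinear {D, A, B}"
    and noncyclic: "\<not> cyclic_quadrilateral A B C D"
  shows "Some P = simson_point A B C D \<longleftrightarrow>
    (cx A - cx P) * (cx C - cx P) = (cx B - cx P) * (cx D - cx P)"
proof -
  have "\<exists>Q. dist B Q = dist C Q \<and> dist C Q = dist D Q"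
  proof -
    define u v where "u = cx C - cx B" and "v = cx D - cx B"
    define N where "N = cnj u * v - u * cnj v"
    have N: "N \<noteq> 0"
      using nd(2) by (simp add: collinear_cx N_def u_def v_def)
    \<comment> \<open>The circumcenter of \<open>0\<close>, \<open>u\<close>, \<open>v\<close>.\<close>
    define q where "q = (u * cnj u * v - v * cnj v * u) / N"
    have "cnj N = - N"
      by (simp add: N_def)
    then have "cnj q = (u * cnj u * cnj v - v * cnj v * cnj u) / - N"
      by (simp add: q_def mult_ac)
    then have qN: "q * N = u * cnj u * v - v * cnj v * u"
        "cnj q * N = v * cnj v * cnj u - u * cnj u * cnj v"
      using N by (simp_all add: q_def)
    have "(u * cnj q + cnj u * q - u * cnj u) * N = 0"
      "(v * cnj q + cnj v * q - v * cnj v) * N = 0"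
      using qN N_def by algebra+
    then have "u * cnj q + cnj u * q - u * cnj u = 0" "v * cnj q + cnj v * q - v * cnj v = 0"
      using N by simp_all
    then have "cmod q = cmod (u - q)" "cmod q = cmod (v - q)"
      unfolding cmod_eq_iff by (simp_all add: algebra_simps)
    then have "dist B (pt (cx B + q)) = dist C (pt (cx B + q)) \<and>
        dist C (pt (cx B + q)) = dist D (pt (cx B + q))"
      by (simp add: dist_cx u_def v_def algebra_simps)
    then show ?thesis by blast
  qed
  then obtain Q R where Q: "dist B Q = R" "dist C Q = R" "dist D Q = R"
    by metis
  define r where "r = complex_of_real R"
  define q where "q = cx Q - cx A"
  have "B \<noteq> C" "B \<noteq> A" "C \<noteq> A" "D \<noteq> A"
    using nd by (auto simp: insert_commute)
  have "r \<noteq> 0"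
    using Q \<open>B \<noteq> C\<close> by (auto simp: r_def)
  have rr: "cnj r = r"
    by (simp add: r_def)
  have on: "(x - q) * cnj (x - q) = r * r" if "x \<in> {cx B - cx A, cx C - cx A, cx D - cx A}" for x
  proof -
    have "cmod (x - q) = R"
      using that Q by (auto simp: q_def dist_cx)
    then show ?thesis
      by (simp only: complex_norm_square [symmetric] r_def) (simp add: power2_eq_square)
  qed
  have off: "q * cnj q \<noteq> r * r"
  proof
    assume "q * cnj q = r * r"
    then have "cmod q = cmod r"
      unfolding cmod_eq_iff rr .
    moreover have "R \<ge> 0"
      using Q by auto
    ultimately have "dist A Q = R"
      by (simp add: q_def r_def dist_cx norm_minus_commute)
    then have "{A, B, C, D} \<subseteq> sphere Q R"
      using Q by (auto simp: dist_commute)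
    then show False
      using noncyclic by (auto simp: cyclic_quadrilateral_def)
  qed
  \<comment> \<open>With \<open>A\<close> at the origin, the circle with center \<open>q\<close> and radius \<open>r\<close> goes under \<open>1 / x\<close> to the
    circle with center \<open>cnj q / (q * cnj q - r * r)\<close> and radius \<open>r\<close> divided by the absolute value
    of the same denominator.\<close>
  define a k where "a = - cnj q / r" and "k = (q * cnj q - r * r) / r"
  define inv where "inv x = a + k / x" for x
  have k: "k \<noteq> 0"
    using off \<open>r \<noteq> 0\<close> by (simp add: k_def)
  have unit: "inv x * cnj (inv x) = 1" and recover: "k / (inv x - a) = x"
    if "x \<in> {cx B - cx A, cx C - cx A, cx D - cx A}" for x
  proof -
    have "x \<noteq> 0"
      using that \<open>B \<noteq> A\<close> \<open>C \<noteq> A\<close> \<open>D \<noteq> A\<close> by auto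
    then show "k / (inv x - a) = x"
      using k by (simp add: inv_def)
    have eq: "q * cnj q - r * r = x * cnj q + cnj x * q - x * cnj x"
      using on [OF that] by (simp add: algebra_simps)
    have "inv x = (q * cnj q - r * r - cnj q * x) / (r * x)"
      using \<open>x \<noteq> 0\<close> \<open>r \<noteq> 0\<close> by (simp add: inv_def a_def k_def field_simps)
    also have "\<dots> = cnj x * (q - x) / (r * x)"
      unfolding eq by (simp add: algebra_simps)
    finally have "inv x = cnj x * (q - x) / (r * x)" .
    then have "inv x * cnj (inv x) =
        cnj x * (q - x) / (r * x) * (x * (cnj q - cnj x) / (r * cnj x))"
      by (simp only: complex_cnj_divide complex_cnj_mult complex_cnj_diff complex_cnj_cnj rr)
    also have "\<dots> = (x - q) * cnj (x - q) / (r * r)"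
      using \<open>x \<noteq> 0\<close> \<open>r \<noteq> 0\<close> by (simp add: divide_simps) (simp add: algebra_simps)
    finally have "inv x * cnj (inv x) = (x - q) * cnj (x - q) / (r * r)" .
    then show "inv x * cnj (inv x) = 1"
      using on [OF that] \<open>r \<noteq> 0\<close> by simp
  qed
  interpret inverted_quadrilateral A B C D a "inv (cx B - cx A)" "inv (cx C - cx A)"
    "inv (cx D - cx A)" k
  proof
    show "a * cnj a \<noteq> 1"
      using off \<open>r \<noteq> 0\<close> by (simp add: a_def rr mult.commute)
  qed (use unit recover k nd noncyclic in auto)
  show ?thesis
    by (rule simson_point_iff)
qed

section \<open>The Simson point of a cyclic quadrilateral\<close>

text \<open>The same equation describes the circle and, when \<open>U\<close> and \<open>V\<close> are antipodal, the line. Divided by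
  \<open>p * cnj p\<close> it is the inverted form, the equation of the line \<open>UV\<close>.\<close>

lemma gen_circle_through_center:
  fixes Q U V P :: point
  defines "u \<equiv> cx U - cx Q" and "v \<equiv> cx V - cx Q" and "p \<equiv> cx P - cx Q"
  assumes r: "u * cnj u = r" "v * cnj v = r" "r \<noteq> 0" and "U \<noteq> V"
  shows "None \<in> gen_circle U Q V \<longleftrightarrow> u + v = 0"
    and "Some P \<in> gen_circle U Q V \<longleftrightarrow> (u + v) * (p * cnj p) = r * p + u * v * cnj p"
proof -
  have ne: "u \<noteq> 0" "v \<noteq> 0" "u \<noteq> v"
    using r \<open>U \<noteq> V\<close> by (auto simp: u_def v_def)
  have cnj_eq: "cnj u = r / u" "cnj v = r / v"
    using r ne by (auto simp: field_simps)
  have "collinear {U, Q, V} \<longleftrightarrow> collinear {Q, U, V}"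
    by (simp add: insert_commute)
  also have "\<dots> \<longleftrightarrow> u * cnj v = cnj u * v"
    by (simp add: collinear_cx u_def v_def)
  also have "\<dots> \<longleftrightarrow> u * u = v * v"
    using ne r(3) by (simp add: cnj_eq field_simps)
  also have "\<dots> \<longleftrightarrow> u + v = 0"
    using ne by (auto simp: square_eq_iff add_eq_0_iff2)
  finally have col: "collinear {U, Q, V} \<longleftrightarrow> u + v = 0" .
  then show "None \<in> gen_circle U Q V \<longleftrightarrow> u + v = 0"
    by (auto simp: gen_circle_def)
  show "Some P \<in> gen_circle U Q V \<longleftrightarrow> (u + v) * (p * cnj p) = r * p + u * v * cnj p"
  proof (cases "u + v = 0")
    case True
    have "collinear {U, V, Q}"
      using col True by (simp add: insert_commute)
    then have "Q \<in> affine hull {U, V}"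
      using \<open>U \<noteq> V\<close> by (simp add: collinear_3_affine_hull)
    then have "affine hull {U, Q, V} = affine hull {U, V}"
      using hull_redundant [of Q affine "{U, V}"] by (simp add: insert_commute)
    then have "Some P \<in> gen_circle U Q V \<longleftrightarrow> P \<in> affine hull {U, V}"
      using col True by (auto simp: gen_circle_def)
    also have "\<dots> \<longleftrightarrow> collinear {U, V, P}"
      using \<open>U \<noteq> V\<close> by (simp add: collinear_3_affine_hull)
    also have "\<dots> \<longleftrightarrow> (v - u) * cnj (p - u) = cnj (v - u) * (p - u)"
      by (simp add: collinear_cx u_def v_def p_def)
    also have "\<dots> \<longleftrightarrow> (u + v) * (p * cnj p) = r * p + u * v * cnj p"
    proof -
      have v: "v = - u"
        using True by (simp add: add_eq_0_iff)
      have "(v - u) * cnj (p - u) - cnj (v - u) * (p - u) = 2 * (cnj u * p - u * cnj p)"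
        unfolding v by (simp add: algebra_simps)
      moreover have "u * (cnj u * p - u * cnj p) = r * p + u * v * cnj p - (u + v) * (p * cnj p)"
        unfolding v r(1) [symmetric] by (simp add: algebra_simps)
      ultimately have "(v - u) * cnj (p - u) - cnj (v - u) * (p - u) = 0 \<longleftrightarrow>
          r * p + u * v * cnj p - (u + v) * (p * cnj p) = 0"
        using ne(1) by (metis mult_eq_0_iff zero_neq_numeral)
      then show ?thesis
        unfolding right_minus_eq by metis
    qed
    finally show ?thesis .
  next
    case False
    \<comment> \<open>The center of the circle through \<open>0\<close>, \<open>u\<close>, \<open>v\<close>.\<close>
    define e where "e = u * v / (u + v)"
    have sum: "r / u + r / v = r * (u + v) / (u * v)"
      using ne by (simp add: field_simps)
    have "cnj e = r / u * (r / v) / (r / u + r / v)"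
      by (simp add: e_def cnj_eq)
    then have cnj_e: "cnj e = r / (u + v)"
      unfolding sum using ne r(3) False by simp
    have e: "(u + v) * e = u * v" "(u + v) * cnj e = r"
      using False unfolding cnj_e by (simp_all add: e_def)
    have on: "cmod (x - e) = cmod e \<longleftrightarrow> (u + v) * (x * cnj x) = r * x + u * v * cnj x" for x
    proof -
      have "(u + v) * ((x - e) * cnj (x - e) - e * cnj e) =
          (u + v) * (x * cnj x) - ((u + v) * cnj e * x + (u + v) * e * cnj x)"
        by (simp add: algebra_simps)
      then have "(x - e) * cnj (x - e) - e * cnj e = 0 \<longleftrightarrow>
          (u + v) * (x * cnj x) - (r * x + u * v * cnj x) = 0"
        unfolding e using False by (metis mult_eq_0_iff)
      then show ?thesis
        unfolding cmod_eq_iff right_minus_eq .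
    qed
    have "cmod (u - e) = cmod e" "cmod (v - e) = cmod e"
      unfolding on r using r(1,2) by (simp_all add: algebra_simps)
    moreover have "dist T (pt (cx Q + e)) = cmod (cx T - cx Q - e)" for T
      by (simp add: dist_cx diff_diff_eq)
    ultimately have "circumcircle U Q V = (pt (cx Q + e), cmod e)"
      using col False by (intro circumcircleI) (simp_all add: u_def v_def)
    then have "Some P \<in> gen_circle U Q V \<longleftrightarrow> dist P (pt (cx Q + e)) = cmod e"
      using col False by (auto simp: gen_circle_def circumcircle_def dist_commute)
    also have "\<dots> \<longleftrightarrow> cmod (p - e) = cmod e"
      by (simp add: dist_cx p_def diff_diff_eq)
    finally show ?thesis
      unfolding on .
  qed
qed

text \<open>If the diagonals are parallel, the vertices form a trapezoid with bases \<open>AC\<close> and \<open>BD\<close>, and two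
  opposite sides of the quadrilateral are the diagonals of this trapezoid, so they cross. Which
  two depends on the orientation of the bases.\<close>

lemma diagonals_not_parallel:
  assumes "nondegenerate_quadrilateral A B C D"
  shows "\<not> parallel (cx A - cx C) (cx B - cx D)"
proof
  assume par: "parallel (cx A - cx C) (cx B - cx D)"
  have "A \<noteq> C" "B \<noteq> D"
    using assms by (auto simp: nondegenerate_quadrilateral_def insert_commute)
  then have ne: "cx A - cx C \<noteq> 0" "cx B - cx D \<noteq> 0"
    by auto
  define t where "t = Re ((cx A - cx C) / (cx B - cx D))"
  have "cnj (cx B - cx D) \<noteq> 0"
    using ne by (metis complex_cnj_zero_iff)
  then have "cnj ((cx A - cx C) / (cx B - cx D)) = (cx A - cx C) / (cx B - cx D)"
    using par ne unfolding parallel_def complex_cnj_divide by (subst frac_eq_eq) (simp_all only: mult.commute not_False_eq_True)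
  then have "(cx A - cx C) / (cx B - cx D) = of_real t"
    unfolding t_def by (metis Reals_cnj_iff of_real_Re)
  then have "cx (A - C) = cx (t *\<^sub>R (B - D))"
    using ne by (simp add: field_simps)
  then have AC: "A - C = t *\<^sub>R (B - D)"
    by (simp only: cx_eq_iff)
  then have "t \<noteq> 0"
    using \<open>A \<noteq> C\<close> by auto
  then consider "t < 0" | "t > 0"
    by linarith
  then show False
  proof cases
    case 1
    \<comment> \<open>Where \<open>AB\<close> and \<open>CD\<close> cross, they divide in the ratio of the bases.\<close>
    define l where "l = - t / (1 - t)"
    have l: "0 \<le> l" "l \<le> 1" "(1 - l) * t + l = 0"
      using 1 by (auto simp: l_def field_simps)
    have "((1 - l) *\<^sub>R A + l *\<^sub>R B) - ((1 - l) *\<^sub>R C + l *\<^sub>R D) =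
        (1 - l) *\<^sub>R (A - C) + l *\<^sub>R (B - D)"
      by (simp add: algebra_simps)
    also have "\<dots> = ((1 - l) * t + l) *\<^sub>R (B - D)"
      unfolding AC scaleR_scaleR scaleR_left_distrib ..
    finally have "(1 - l) *\<^sub>R A + l *\<^sub>R B = (1 - l) *\<^sub>R C + l *\<^sub>R D"
      unfolding l(3) by simp
    then have "(1 - l) *\<^sub>R A + l *\<^sub>R B \<in> closed_segment A B \<inter> closed_segment C D"
      using l(1,2) unfolding closed_segment_def by blast
    then show False
      using assms by (auto simp: nondegenerate_quadrilateral_def)
  next
    case 2
    \<comment> \<open>The same ratio for the crossing of \<open>DA\<close> and \<open>BC\<close>.\<close>
    define l where "l = t / (1 + t)"
    have l: "0 \<le> l" "l \<le> 1" "(1 - l) * t - l = 0"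
      using 2 by (auto simp: l_def field_simps)
    have "((1 - l) *\<^sub>R A + l *\<^sub>R D) - ((1 - l) *\<^sub>R C + l *\<^sub>R B) =
        (1 - l) *\<^sub>R (A - C) - l *\<^sub>R (B - D)"
      by (simp add: algebra_simps)
    also have "\<dots> = ((1 - l) * t - l) *\<^sub>R (B - D)"
      unfolding AC scaleR_scaleR scaleR_left_diff_distrib ..
    finally have "(1 - l) *\<^sub>R A + l *\<^sub>R D = (1 - l) *\<^sub>R C + l *\<^sub>R B"
      unfolding l(3) by simp
    then have "(1 - l) *\<^sub>R A + l *\<^sub>R D \<in> closed_segment A D \<inter> closed_segment C B"
      using l(1,2) unfolding closed_segment_def by blast
    then show False
      using assms by (auto simp: nondegenerate_quadrilateral_def closed_segment_commute)
  qed
qed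

text \<open>Subtracting the equations of the two circles leaves the linear equation \<open>M * p = N\<close>, where \<open>N\<close>
  is nonzero because the diagonals are not parallel. For \<open>M = 0\<close> the diagonals meet in the
  circumcenter, and the common point is at infinity.\<close>

lemma simson_point_cyclic_iff:
  assumes nd: "nondegenerate_quadrilateral A B C D" and cyclic: "cyclic_quadrilateral A B C D"
  shows "Some P = simson_point A B C D \<longleftrightarrow>
    (cx A - cx P) * (cx C - cx P) = (cx B - cx P) * (cx D - cx P)"
proof -
  obtain Q R where "{A, B, C, D} \<subseteq> sphere Q R"
    using cyclic by (auto simp: cyclic_quadrilateral_def)
  then have dist: "dist A Q = R" "dist B Q = R" "dist C Q = R" "dist D Q = R"
    by (auto simp: dist_commute)
  have "\<not> collinear {A, B, C}" and "A \<noteq> B" "A \<noteq> C" "B \<noteq> D"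
    using nd by (auto simp: nondegenerate_quadrilateral_def insert_commute)
  then have Q: "circumcenter A B C = Q"
    using circumcircleI [of A B C Q R] dist by (simp add: circumcircle_def)
  define a b c d r where "a = cx A - cx Q" and "b = cx B - cx Q"
    and "c = cx C - cx Q" and "d = cx D - cx Q" and "r = complex_of_real (R * R)"
  have on: "(cx T - cx Q) * cnj (cx T - cx Q) = r" if "dist T Q = R" for T
    using that unfolding dist_cx r_def
    by (metis complex_norm_square power2_eq_square)
  have circ: "a * cnj a = r" "b * cnj b = r" "c * cnj c = r" "d * cnj d = r"
    unfolding a_def b_def c_def d_def by (simp_all only: on dist)
  have "R \<noteq> 0"
    using dist \<open>A \<noteq> B\<close> by auto
  then have "r \<noteq> 0"
    by (simp add: r_def)
  then have ne: "a \<noteq> 0" "b \<noteq> 0" "c \<noteq> 0" "d \<noteq> 0"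
    using circ by auto
  have cnj_eq: "cnj a = r / a" "cnj b = r / b" "cnj c = r / c" "cnj d = r / d"
    using circ ne by (auto simp: field_simps)
  note gen = gen_circle_through_center [of B Q r D, folded b_def d_def, OF circ(2,4) \<open>r \<noteq> 0\<close> \<open>B \<noteq> D\<close>]
    gen_circle_through_center [of A Q r C, folded a_def c_def, OF circ(1,3) \<open>r \<noteq> 0\<close> \<open>A \<noteq> C\<close>]
  define M N where "M = a + c - b - d" and "N = a * c - b * d"
  have N: "N \<noteq> 0"
  proof
    assume "N = 0"
    then have "a * c = b * d"
      by (simp add: N_def)
    then have "(a - c) * cnj (b - d) = cnj (a - c) * (b - d)"
      using ne by (simp add: cnj_eq field_simps)
    then have "parallel (cx A - cx C) (cx B - cx D)"
      by (simp add: parallel_def a_def b_def c_def d_def)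
    then show False
      using diagonals_not_parallel [OF nd] by contradiction
  qed
  have cnj_N: "a * b * c * d * cnj N = - (r * r * N)"
    using ne by (simp add: N_def cnj_eq field_simps)
  define L where "L = (b + d) * a * c - (a + c) * b * d"
  have cnj_M: "a * b * c * d * cnj M = - (r * L)"
    using ne by (simp add: M_def L_def cnj_eq field_simps)
  define meets where "meets T \<longleftrightarrow> T \<in> gen_circle B Q D \<and> T \<in> gen_circle A Q C \<and> T \<noteq> Some Q" for T
  have simson: "simson_point A B C D = (THE T. meets T)"
    using cyclic by (simp add: simson_point_def Q meets_def Let_def)
  have meets_None: "meets None \<longleftrightarrow> M = 0"
  proof
    assume "M = 0"
    then have "L = 0"
      using cnj_M \<open>r \<noteq> 0\<close> by simp
    moreover have "L = (b + d) * N - b * d * M"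
      by (simp add: L_def M_def N_def algebra_simps)
    ultimately have "b + d = 0"
      using N \<open>M = 0\<close> by simp
    moreover have "a + c = 0"
      using \<open>M = 0\<close> calculation unfolding M_def by algebra
    ultimately show "meets None"
      by (simp add: meets_def gen)
  next
    assume "meets None"
    then have "b + d = 0" "a + c = 0"
      by (simp_all add: meets_def gen)
    then show "M = 0"
      unfolding M_def by algebra
  qed
  have meets_Some: "meets (Some T) \<longleftrightarrow> M * (cx T - cx Q) = N" for T
  proof -
    define p where "p = cx T - cx Q"
    have "meets (Some T) \<longleftrightarrow> (b + d) * (p * cnj p) = r * p + b * d * cnj p \<and>
        (a + c) * (p * cnj p) = r * p + a * c * cnj p \<and> p \<noteq> 0"
      by (simp add: meets_def gen p_def)
    also have "\<dots> \<longleftrightarrow> M * p = N"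
    proof
      assume h: "(b + d) * (p * cnj p) = r * p + b * d * cnj p \<and>
          (a + c) * (p * cnj p) = r * p + a * c * cnj p \<and> p \<noteq> 0"
      have "cnj p * (M * p - N) = ((a + c) * (p * cnj p) - (r * p + a * c * cnj p))
          - ((b + d) * (p * cnj p) - (r * p + b * d * cnj p))"
        by (simp add: M_def N_def algebra_simps)
      also have "\<dots> = 0"
        using h by simp
      finally show "M * p = N"
        using h by simp
    next
      assume p: "M * p = N"
      have "r * (L * cnj p - r * N) = 0"
      proof -
        have "a * b * c * d * cnj M * cnj p = a * b * c * d * cnj N"
          using arg_cong [OF p, of cnj] by simp
        then show ?thesis
          unfolding cnj_M cnj_N by (simp add: algebra_simps)
      qed
      then have p': "L * cnj p = r * N"
        using \<open>r \<noteq> 0\<close> by simp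
      \<comment> \<open>Multiplied by \<open>M\<close>, both circle equations reduce to the conjugate of \<open>M * p = N\<close>.\<close>
      have "M * ((b + d) * (p * cnj p) - (r * p + b * d * cnj p)) =
          (b + d) * (M * p) * cnj p - r * (M * p) - b * d * M * cnj p"
        by (simp add: algebra_simps)
      also have "\<dots> = L * cnj p - r * N"
        unfolding p by (simp add: L_def M_def N_def algebra_simps)
      finally have 1: "M * ((b + d) * (p * cnj p) - (r * p + b * d * cnj p)) = 0"
        unfolding p' by simp
      have "M * ((a + c) * (p * cnj p) - (r * p + a * c * cnj p)) =
          (a + c) * (M * p) * cnj p - r * (M * p) - a * c * M * cnj p"
        by (simp add: algebra_simps)
      also have "\<dots> = L * cnj p - r * N"
        unfolding p by (simp add: L_def M_def N_def algebra_simps)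
      finally have 2: "M * ((a + c) * (p * cnj p) - (r * p + a * c * cnj p)) = 0"
        unfolding p' by simp
      have "M \<noteq> 0" "p \<noteq> 0"
        using p N by auto
      then show "(b + d) * (p * cnj p) = r * p + b * d * cnj p \<and>
          (a + c) * (p * cnj p) = r * p + a * c * cnj p \<and> p \<noteq> 0"
        using 1 2 by simp
    qed
    finally show ?thesis
      by (simp only: p_def)
  qed
  have "Some P = simson_point A B C D \<longleftrightarrow> M * (cx P - cx Q) = N"
  proof (cases "M = 0")
    case True
    have "(THE T. meets T) = None"
    proof (rule the_equality)
      show "T = None" if "meets T" for T
        using that meets_Some True N by (cases T) auto
    qed (simp add: meets_None True)
    then show ?thesis
      unfolding simson using True N by simp
  next
    case False
    define S where "S = pt (cx Q + N / M)"
    have S: "M * (cx T - cx Q) = N \<longleftrightarrow> T = S" for T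
    proof -
      have "M * (cx T - cx Q) = N \<longleftrightarrow> cx T = cx S"
        using False by (auto simp: S_def field_simps)
      then show ?thesis by simp
    qed
    have "(THE T. meets T) = Some S"
    proof (rule the_equality)
      show "T = Some S" if "meets T" for T
        using that meets_Some meets_None False S by (cases T) auto
    qed (simp add: meets_Some S)
    then show ?thesis
      unfolding simson S by simp
  qed
  also have "\<dots> \<longleftrightarrow> (cx A - cx P) * (cx C - cx P) = (cx B - cx P) * (cx D - cx P)"
  proof -
    have "(cx A - cx P) * (cx C - cx P) - (cx B - cx P) * (cx D - cx P) =
        N - M * (cx P - cx Q)"
      by (simp add: M_def N_def a_def b_def c_def d_def algebra_simps)
    then show ?thesis
      by (metis right_minus_eq)
  qed
  finally show ?thesis .
qed

theorem theorem30:
  fixes A B C D :: point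
  assumes "nondegenerate_quadrilateral A B C D"
  shows "(\<forall>P. collinear {foot P A B, foot P B C, foot P C D, foot P D A} \<longleftrightarrow>
              Some P = simson_point A B C D) \<and>
         (simson_point A B C D = None \<longrightarrow>
              (\<forall>P. \<not> collinear {foot P A B, foot P B C, foot P C D, foot P D A})) \<and>
         (B - A = C - D \<longrightarrow> simson_point A B C D = None)"
proof -
  have nd: "\<not> collinear {A, B, C}" "\<not> collinear {B, C, D}"
    "\<not> collinear {C, D, A}" "\<not> collinear {D, A, B}"
    using assms by (auto simp: nondegenerate_quadrilateral_def)
  have simson: "Some P = simson_point A B C D \<longleftrightarrow>
      (cx A - cx P) * (cx C - cx P) = (cx B - cx P) * (cx D - cx P)" for P
    using simson_point_cyclic_iff [OF assms] simson_point_noncyclic_iff [OF nd] by blast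
  have feet: "collinear {foot P A B, foot P B C, foot P C D, foot P D A} \<longleftrightarrow>
      Some P = simson_point A B C D" for P
    unfolding collinear_feet_iff [OF nd] simson ..
  have "simson_point A B C D = None" if "B - A = C - D"
  proof (rule ccontr)
    assume "simson_point A B C D \<noteq> None"
    then obtain P where "Some P = simson_point A B C D"
      by (metis not_None_eq)
    then have "(cx A - cx P) * (cx C - cx P) = (cx B - cx P) * (cx D - cx P)"
      using simson by blast
    moreover have "cx B - cx A = cx C - cx D"
      using that by (simp flip: cx_diff)
    ultimately have "(cx A - cx B) * (cx A - cx D) = 0"
      by algebra
    then show False
      using nd by (auto simp: insert_commute)
  qed
  then show ?thesis
    using feet by auto
qed

end
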